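(* Let $I\subset\mathbb{R}$ be a nondegenerate compact interval, and let $(\xi_n)_{n\in\mathbb{N}}$ be a sequence of independent and identically distributed (real-valued) random variables on a probability space $(\Omega,\mathcal{A},\mathbb{P})$ such that $\mathbb{P}(\xi_1\in[0,1])=1$. For each $n\in\mathbb{N}$, let $M_n:\Omega\to\mathcal{M}_2$, $$(M_n(\omega))(x_1,x_2):=\xi_n(\omega)x_1+(1-\xi_n(\omega))x_2,\qquad x_1,x_2\in I,$$ for all $\omega\in\Omega$ with $\xi_n(\omega)\in[0,1]$, and $M_n(\omega):=m^*$ for all other $\omega\in\Omega$ (a $\mathbb{P}$-null event), where $m^*\in\mathcal{M}_2$ is a fixed, arbitrary mean. Then for each $n\in\mathbb{N}$, $M_n$ is a random mean generated by $\xi_n$, and $$\mathbb{P}\Big(\big\{\omega\in\Omega:\lim_{n\to\infty}\kappa_n(\omega)=0\big\}\Big)=1,$$ where $$\kappa_n(\omega):=\sup_{x\in I^2}\Big|\frac1n\sum_{j=1}^n (M_j(\omega))(x)-(\mathbb{E}(M_1))(x)\Big|,\qquad \omega\in\Omega,$$ with $(\mathbb{E}(M_1))(x_1,x_2)=x_1\mathbb{E}(\xi_1)+x_2(1-\mathbb{E}(\xi_1))$, $x_1,x_2\in I$. Further, as $n\to\infty$, $$\sqrt n\,\kappa_n\ \stackrel{\mathcal{D}}{\longrightarrow}\ \sup_{x_1,x_2\in I}|x_1-x_2|\cdot\big|\mathcal{N}\big(0,\mathbb{D}^2(\xi_1)\big)\big|.$$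
   Context: $\mathbb{N}$ is the set of positive integers. A nondegenerate interval is one containing at least two distinct points. $\mathcal{B}(\cdot)$ denotes the Borel $\sigma$-algebra. $\mathcal{C}(I^p)$ is the Banach space of real-valued continuous functions on $I^p$ with the supremum norm. $\mathbb{D}^2(\xi_1)$ is the variance of $\xi_1$, $\stackrel{\mathcal{D}}{\longrightarrow}$ denotes convergence in distribution, and $\mathcal{N}(0,\sigma^2)$ in the limit denotes a random variable with the normal distribution of mean $0$ and variance $\sigma^2$, where $\mathcal{N}(0,0)$ is the Dirac distribution concentrated at $0$. $\mathcal{M}_p\subset\mathcal{C}(I^p)$ is the set of $p$-variable (continuous) means on $I$: those $m\in\mathcal{C}(I^p)$ with $\min(x)\le m(x)\le\max(x)$ for all $x\in I^p$, where $\min(x)$ and $\max(x)$ are the minimum and maximum of the coordinates of $x$. Here $p=2$. Definition (random mean generated by $\xi$). Let $\xi:\Omega\to\mathbb{R}^d$ be a random variable on $(\Omega,\mathcal{A},\mathbb{P})$. A map $M:\Omega\to\mathcal{M}_p$ is called a ($p$-variable, continuous) random mean (in $I$) generated by $\xi$ if: (i) $M$ is $(\mathcal{A},\mathcal{B}(\mathcal{C}(I^p)))$-measurable; and (ii) there is a $(\mathcal{B}(I^p)\times\mathcal{B}(\mathbb{R}^d),\mathcal{B}(I))$-measurable map $M_\xi:I^p\times\mathbb{R}^d\to I$ such that (a) for every $\omega\in\Omega$ the map $I^p\ni x\mapsto M_\xi(x,\xi(\omega))$ is in $\mathcal{C}(I^p)$, and (b) $\mathbb{P}(\{\omega\in\Omega:(M(\omega))(x)=M_\xi(x,\xi(\omega))\text{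 for every }x\in I^p\})=1$. Expected value. For such an $M$, $\mathbb{E}(M):=\int_\Omega M(\omega)\,\mathrm{d}\mathbb{P}(\omega)\in\mathcal{C}(I^p)$ is the Bochner integral of $M$ regarded as a map into $\mathcal{C}(I^p)$. *)

theory Defs
  imports "HOL-Probability.Probability"
begin

definition cube :: "real set \<Rightarrow> (real^'p) set" where
  "cube I = {x. \<forall>i. x $ i \<in> I}"

text \<open>The space of real continuous functions on \<open>K\<close> with the supremum metric (\<open>K\<close> will be
  compact). Its elements are extensional, i.e. they equal \<^const>\<open>undefined\<close> outside \<open>K\<close>,
  so a function on \<open>K\<close> has a unique representative.\<close>

definition cont_space :: "'k::topological_space set \<Rightarrow> ('k \<Rightarrow> real) metric" where
  "cont_space K = cfunspace (top_of_set K) euclidean_metric"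

definition borel_cont :: "'k::topological_space set \<Rightarrow> ('k \<Rightarrow> real) measure" where
  "borel_cont K = sigma (mspace (cont_space K)) {U. openin (mtopology_of (cont_space K)) U}"

definition means :: "real set \<Rightarrow> (real^'p \<Rightarrow> real) set" where
  "means I = {m \<in> mspace (cont_space (cube I)).
     \<forall>x\<in>cube I. Min (range (\<lambda>i. x $ i)) \<le> m x \<and> m x \<le> Max (range (\<lambda>i. x $ i))}"

definition random_mean ::
    "'w measure \<Rightarrow> real set \<Rightarrow> ('w \<Rightarrow> 'e::euclidean_space) \<Rightarrow> ('w \<Rightarrow> real^'p \<Rightarrow> real) \<Rightarrow> bool" where
  "random_mean P I \<xi> M \<longleftrightarrow>
     \<xi> \<in> borel_measurable P \<and>
     M \<in> space P \<rightarrow> means I \<and>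
     M \<in> measurable P (borel_cont (cube I)) \<and>
     (\<exists>F. (\<lambda>(x, v). F x v) \<in>
            measurable (restrict_space borel (cube I) \<Otimes>\<^sub>M borel) (restrict_space borel I) \<and>
          (\<forall>\<omega>\<in>space P. (\<lambda>x\<in>cube I. F x (\<xi> \<omega>)) \<in> mspace (cont_space (cube I))) \<and>
          measure P {\<omega>\<in>space P. \<forall>x\<in>cube I. M \<omega> x = F x (\<xi> \<omega>)} = 1)"

text \<open>The Bochner integral in \<open>cont_space K\<close>. The library's \<^const>\<open>has_bochner_integral\<close> needs
  the target to be a separable normed space given by a type, whereas here the space depends on
  the set \<open>K\<close>; the following definitions repeat the library's construction for this space.
  The measure is meant to be finite, so simple functions need no condition on their support.\<close>

definition simple_cont :: "'w measure \<Rightarrow> 'k::topological_space set \<Rightarrow> ('w \<Rightarrow> 'k \<Rightarrow> real) \<Rightarrow> bool" where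
  "simple_cont P K s \<longleftrightarrow> simple_function P s \<and> s \<in> space P \<rightarrow> mspace (cont_space K)"

definition simple_cont_integral ::
    "'w measure \<Rightarrow> 'k::topological_space set \<Rightarrow> ('w \<Rightarrow> 'k \<Rightarrow> real) \<Rightarrow> 'k \<Rightarrow> real" where
  "simple_cont_integral P K s =
     (\<lambda>x\<in>K. \<Sum>f\<in>s ` space P. measure P {\<omega>\<in>space P. s \<omega> = f} * f x)"

definition has_cont_integral ::
    "'w measure \<Rightarrow> 'k::topological_space set \<Rightarrow> ('w \<Rightarrow> 'k \<Rightarrow> real) \<Rightarrow> ('k \<Rightarrow> real) \<Rightarrow> bool" where
  "has_cont_integral P K M e \<longleftrightarrow>
     M \<in> measurable P (borel_cont K) \<and> e \<in> mspace (cont_space K) \<and>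
     (\<exists>s. (\<forall>i. simple_cont P K (s i)) \<and>
          (\<lambda>i. \<integral>\<^sup>+\<omega>. ennreal (mdist (cont_space K) (M \<omega>) (s i \<omega>)) \<partial>P) \<longlonglongrightarrow> 0 \<and>
          (\<lambda>i. mdist (cont_space K) (simple_cont_integral P K (s i)) e) \<longlonglongrightarrow> 0)"

definition cont_integrable ::
    "'w measure \<Rightarrow> 'k::topological_space set \<Rightarrow> ('w \<Rightarrow> 'k \<Rightarrow> real) \<Rightarrow> bool" where
  "cont_integrable P K M \<longleftrightarrow> (\<exists>e. has_cont_integral P K M e)"

definition cont_integral ::
    "'w measure \<Rightarrow> 'k::topological_space set \<Rightarrow> ('w \<Rightarrow> 'k \<Rightarrow> real) \<Rightarrow> 'k \<Rightarrow> real" where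
  "cont_integral P K M = (THE e. has_cont_integral P K M e)"

text \<open>The second parameter is the variance; \<open>v = 0\<close> gives the Dirac distribution, which
  \<^const>\<open>normal_density\<close> does not cover.\<close>

definition normal_law :: "real \<Rightarrow> real \<Rightarrow> real measure" where
  "normal_law \<mu> v =
     (if v = 0 then return borel \<mu> else density lborel (\<lambda>x. ennreal (normal_density \<mu> (sqrt v) x)))"

definition converges_in_distribution ::
    "'w measure \<Rightarrow> (nat \<Rightarrow> 'w \<Rightarrow> real) \<Rightarrow> 'v measure \<Rightarrow> ('v \<Rightarrow> real) \<Rightarrow> bool" where
  "converges_in_distribution P X Q Y \<longleftrightarrow>
     (\<forall>n\<ge>1. X n \<in> borel_measurable P) \<and> Y \<in> borel_measurable Q \<and>
     weak_conv_m (\<lambda>n. distr P borel (X n)) (distr Q borel Y)"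

end

(* On the almost sure event that all weights lie in [0,1], the average of M_1, ..., M_n is
   the weighted mean whose weight is the average A_n of the weights. As two weighted means
   with weights s and t differ by (s - t) (x_1 - x_2), kappa_n = |A_n - E xi_1| * diam I, so
   everything reduces to real random variables: the strong law follows from Hoeffding's
   inequality and Borel-Cantelli, and the limit distribution from the central limit theorem
   and the continuous mapping theorem. Evaluation at a point is 1-Lipschitz for the supremum
   metric, so the Bochner integral, if it exists, is the pointwise integral. Off that event
   kappa_n is still measurable, as a supremum over a countable dense set. *)

theory Submission
  imports Defs
begin

section \<open>The space of continuous functions on a compact set\<close>

text \<open>Continuous functions on a compact set are bounded, so the boundedness that
  \<open>cfunspace\<close> imposes is automatic and only continuity and extensionality
  remain.\<close>

lemma mspace_cont_space:
  assumes "compact K"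
  shows "mspace (cont_space K) = {f \<in> extensional K. continuous_on K f}"
proof -
  have "compactin (top_of_set K) (topspace (top_of_set K))"
    using assms by (simp add: compactin_subtopology)
  then show ?thesis
    by (auto simp: cont_space_def compactin_mspace_cfunspace simp del: mspace_cfunspace)
qed

lemma mdist_cont_space_le:
  assumes "0 \<le> B" "\<And>x. x \<in> K \<Longrightarrow> \<bar>f x - g x\<bar> \<le> B"
  shows "mdist (cont_space K) f g \<le> B"
  using assms unfolding cont_space_def by (intro mdist_cfunspace_le) (auto simp: dist_real_def)

lemma abs_diff_le_mdist_cont_space:
  assumes "f \<in> mspace (cont_space K)" "g \<in> mspace (cont_space K)" "x \<in> K"
  shows "\<bar>f x - g x\<bar> \<le> mdist (cont_space K) f g"
  using mdist_cfunspace_imp_mdist_le[of f "top_of_set K" euclidean_metric g _ x] assms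
  unfolding cont_space_def by (simp add: dist_real_def)

lemma borel_cont_generators:
  "{U. openin (mtopology_of (cont_space K)) U} \<subseteq> Pow (mspace (cont_space K))"
  using openin_subset by force

lemma space_borel_cont: "space (borel_cont K) = mspace (cont_space K)"
  unfolding borel_cont_def by (rule space_measure_of[OF borel_cont_generators])

text \<open>Evaluation at \<open>x\<close> is 1-Lipschitz for the supremum metric, hence continuous,
  so the preimage of an open set is itself one of the open sets generating
  \<open>borel_cont K\<close>.\<close>

lemma measurable_borel_cont_eval:
  assumes "x \<in> K"
  shows "(\<lambda>f. f x) \<in> borel_measurable (borel_cont K)"
proof (rule borel_measurableI)
  fix S :: "real set"
  assume "open S"
  have "Lipschitz_continuous_map (cont_space K) euclidean_metric (\<lambda>f. f x)"
    unfolding Lipschitz_continuous_map_def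
    using abs_diff_le_mdist_cont_space[OF _ _ assms]
    by (auto simp: dist_real_def intro!: exI[of _ 1])
  then have "continuous_map (mtopology_of (cont_space K)) euclidean (\<lambda>f. f x)"
    using Lipschitz_continuous_imp_continuous_map by fastforce
  then have "openin (mtopology_of (cont_space K)) {f \<in> mspace (cont_space K). f x \<in> S}"
    using \<open>open S\<close> by (auto simp: continuous_map)
  moreover have "(\<lambda>f. f x) -` S \<inter> space (borel_cont K) = {f \<in> mspace (cont_space K). f x \<in> S}"
    by (auto simp: space_borel_cont)
  ultimately show "(\<lambda>f. f x) -` S \<inter> space (borel_cont K) \<in> sets (borel_cont K)"
    by (simp add: borel_cont_def sets_measure_of[OF borel_cont_generators])
qed

section \<open>The Bochner integral is the pointwise integral\<close>

context finite_measure
begin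

text \<open>A simple function is the finite sum of its values times the indicators of its fibres;
  evaluating at \<open>x\<close> and integrating term by term gives both claims.\<close>

lemma simple_cont_integral_eval:
  assumes s: "simple_cont M K s" and x: "x \<in> K"
  shows "integrable M (\<lambda>\<omega>. s \<omega> x)"
    and "simple_cont_integral M K s x = (\<integral>\<omega>. s \<omega> x \<partial>M)"
proof -
  have sf: "simple_function M s"
    using s by (simp add: simple_cont_def)
  have fin: "finite (s ` space M)"
    using sf by (rule simple_functionD)
  have sets: "{\<omega> \<in> space M. s \<omega> = f} \<in> sets M" for f
    using simple_functionD(2)[OF sf, of "{f}"] by (simp add: vimage_def Int_def conj_commute)
  have eq: "s \<omega> x = (\<Sum>f\<in>s ` space M. indicator {\<omega> \<in> space M. s \<omega> = f} \<omega> * f x)"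
    if "\<omega> \<in> space M" for \<omega>
  proof -
    have "(\<Sum>f\<in>s ` space M. indicator {\<omega> \<in> space M. s \<omega> = f} \<omega> * f x) =
        (\<Sum>f\<in>s ` space M. if f = s \<omega> then f x else 0)"
      using that by (intro sum.cong) (auto simp: indicator_def)
    with fin that show ?thesis by simp
  qed
  have int: "integrable M (\<lambda>\<omega>. indicator {\<omega> \<in> space M. s \<omega> = f} \<omega> * f x)" for f
    using sets by (intro integrable_mult_left integrable_real_indicator) (auto simp: less_top[symmetric])
  then have "integrable M (\<lambda>\<omega>. \<Sum>f\<in>s ` space M. indicator {\<omega> \<in> space M. s \<omega> = f} \<omega> * f x)"
    by (intro Bochner_Integration.integrable_sum)
  then show "integrable M (\<lambda>\<omega>. s \<omega> x)"
    by (subst Bochner_Integration.integrable_cong[OF refl eq])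
  have "(\<integral>\<omega>. s \<omega> x \<partial>M) = (\<integral>\<omega>. (\<Sum>f\<in>s ` space M. indicator {\<omega> \<in> space M. s \<omega> = f} \<omega> * f x) \<partial>M)"
    by (rule Bochner_Integration.integral_cong[OF refl eq])
  also have "\<dots> = (\<Sum>f\<in>s ` space M. measure M {\<omega> \<in> space M. s \<omega> = f} * f x)"
    using int sets by (subst Bochner_Integration.integral_sum) (auto intro!: sum.cong simp: Int_absorb1)
  finally show "simple_cont_integral M K s x = (\<integral>\<omega>. s \<omega> x \<partial>M)"
    using x by (simp add: simple_cont_integral_def)
qed

lemma simple_cont_integral_mspace:
  assumes s: "simple_cont M K s" and K: "compact K"
  shows "simple_cont_integral M K s \<in> mspace (cont_space K)"
proof -
  have "continuous_on K (\<lambda>x. \<Sum>f\<in>s ` space M. measure M {\<omega> \<in> space M. s \<omega> = f} * f x)"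
    using s by (intro continuous_intros) (auto simp: simple_cont_def mspace_cont_space[OF K])
  then show ?thesis
    unfolding mspace_cont_space[OF K] simple_cont_integral_def
    by (auto cong: continuous_on_cong)
qed

text \<open>Evaluation at \<open>x\<close> does not increase distances. Simple functions that
  approximate \<open>X\<close> in mean therefore still do so after evaluation, and this L1
  convergence of real functions yields integrability and convergence of the integrals.\<close>

lemma has_cont_integral_eval:
  assumes "has_cont_integral M K X e" and K: "compact K" and x: "x \<in> K"
  shows "integrable M (\<lambda>\<omega>. X \<omega> x)" and "e x = (\<integral>\<omega>. X \<omega> x \<partial>M)"
proof -
  obtain s where X: "X \<in> measurable M (borel_cont K)" and e: "e \<in> mspace (cont_space K)"
    and s: "\<And>i. simple_cont M K (s i)"
    and L1: "(\<lambda>i. \<integral>\<^sup>+\<omega>. ennreal (mdist (cont_space K) (X \<omega>) (s i \<omega>)) \<partial>M) \<longlonglongrightarrow> 0"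
    and lim: "(\<lambda>i. mdist (cont_space K) (simple_cont_integral M K (s i)) e) \<longlonglongrightarrow> 0"
    using assms(1) by (auto simp: has_cont_integral_def)
  have Xsp: "X \<omega> \<in> mspace (cont_space K)" if "\<omega> \<in> space M" for \<omega>
    using measurable_space[OF X that] by (simp add: space_borel_cont)
  have Xm [measurable]: "(\<lambda>\<omega>. X \<omega> x) \<in> borel_measurable M"
    using measurable_compose[OF X measurable_borel_cont_eval[OF x]] .
  note si = simple_cont_integral_eval[OF s x]
  have [measurable]: "(\<lambda>\<omega>. s i \<omega> x) \<in> borel_measurable M" for i
    using si(1) by (rule borel_measurable_integrable)
  have le: "(\<integral>\<^sup>+\<omega>. norm (s i \<omega> x - X \<omega> x) \<partial>M)
      \<le> (\<integral>\<^sup>+\<omega>. ennreal (mdist (cont_space K) (X \<omega>) (s i \<omega>)) \<partial>M)" for i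
    using s[of i] Xsp x
    by (intro nn_integral_mono ennreal_leI)
       (auto simp: simple_cont_def abs_minus_commute intro!: abs_diff_le_mdist_cont_space)
  have conv: "(\<lambda>i. \<integral>\<^sup>+\<omega>. norm (s i \<omega> x - X \<omega> x) \<partial>M) \<longlonglongrightarrow> 0"
    using tendsto_sandwich[OF _ _ tendsto_const L1] le by simp
  \<comment> \<open>A single \<open>s i\<close> at finite L1 distance suffices: its evaluation at
    \<open>x\<close> is integrable, hence so is that of \<open>X\<close>.\<close>
  then have "\<forall>\<^sub>F i in sequentially. (\<integral>\<^sup>+\<omega>. norm (s i \<omega> x - X \<omega> x) \<partial>M) < \<infinity>"
    by (rule order_tendstoD) simp
  then obtain i where "(\<integral>\<^sup>+\<omega>. norm (s i \<omega> x - X \<omega> x) \<partial>M) < \<infinity>"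
    by (auto simp: eventually_sequentially)
  then have "integrable M (\<lambda>\<omega>. s i \<omega> x - X \<omega> x)"
    by (intro integrableI_bounded) simp_all
  from Bochner_Integration.integrable_diff[OF si(1)[of i] this]
  show int: "integrable M (\<lambda>\<omega>. X \<omega> x)" by simp
  have "(\<lambda>i. \<integral>\<omega>. s i \<omega> x \<partial>M) \<longlonglongrightarrow> (\<integral>\<omega>. X \<omega> x \<partial>M)"
    by (rule tendsto_L1_int[OF si(1) int conv])
  \<comment> \<open>The integrals of the \<open>s i\<close> tend to \<open>e\<close> in the supremum
    metric, in particular at \<open>x\<close>.\<close>
  moreover have "(\<lambda>i. \<integral>\<omega>. s i \<omega> x \<partial>M) \<longlonglongrightarrow> e x"
  proof (rule LIM_zero_cancel, rule Lim_null_comparison[OF _ lim])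
    show "\<forall>\<^sub>F i in sequentially. norm ((\<integral>\<omega>. s i \<omega> x \<partial>M) - e x)
        \<le> mdist (cont_space K) (simple_cont_integral M K (s i)) e"
      using abs_diff_le_mdist_cont_space[OF simple_cont_integral_mspace[OF s K] e x]
      by (simp add: si)
  qed
  ultimately show "e x = (\<integral>\<omega>. X \<omega> x \<partial>M)"
    by (rule LIMSEQ_unique[symmetric])
qed

text \<open>Uniqueness behind \<open>THE\<close>: any two integrals agree with the pointwise
  integrals on \<open>K\<close>, and with each other off \<open>K\<close> by extensionality.\<close>

lemma cont_integral_eqI:
  assumes e: "has_cont_integral M K X e" and K: "compact K"
  shows "cont_integral M K X = e"
  unfolding cont_integral_def
proof (rule the_equality[where a = e])
  fix e'
  assume e': "has_cont_integral M K X e'"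
  show "e' = e"
  proof (rule extensionalityI[of _ K])
    show "e' \<in> extensional K" "e \<in> extensional K"
      using e e' by (auto simp: has_cont_integral_def mspace_cont_space[OF K])
  qed (simp add: has_cont_integral_eval(2)[OF e K] has_cont_integral_eval(2)[OF e' K])
qed (rule e)

end

text \<open>The total mass is 1, so a uniform error \<open>B i\<close> of the simple functions
  bounds their L1 distance from \<open>X\<close>; integrating pointwise, it also bounds the distance
  of their integrals from \<open>e\<close>.\<close>

lemma (in prob_space) has_cont_integralI_uniform:
  assumes K: "compact K" and X: "X \<in> measurable M (borel_cont K)"
    and s: "\<And>i. simple_cont M K (s i)"
    and B: "\<And>i. 0 \<le> B i" "B \<longlonglongrightarrow> 0"
    and close: "\<And>i \<omega> x. \<omega> \<in> space M \<Longrightarrow> x \<in> K \<Longrightarrow> \<bar>X \<omega> x - s i \<omega> x\<bar> \<le> B i"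
    and e: "e \<in> mspace (cont_space K)"
    and int: "\<And>x. x \<in> K \<Longrightarrow> has_bochner_integral M (\<lambda>\<omega>. X \<omega> x) (e x)"
  shows "has_cont_integral M K X e"
  unfolding has_cont_integral_def
proof (intro conjI exI[of _ s] allI X e s)
  have "(\<integral>\<^sup>+\<omega>. ennreal (mdist (cont_space K) (X \<omega>) (s i \<omega>)) \<partial>M) \<le> ennreal (B i)" for i
  proof -
    have "(\<integral>\<^sup>+\<omega>. ennreal (mdist (cont_space K) (X \<omega>) (s i \<omega>)) \<partial>M) \<le> (\<integral>\<^sup>+\<omega>. ennreal (B i) \<partial>M)"
      using B(1) close by (intro nn_integral_mono ennreal_leI mdist_cont_space_le) auto
    then show ?thesis by (simp add: emeasure_space_1)
  qed
  moreover have "(\<lambda>i. ennreal (B i)) \<longlonglongrightarrow> 0"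
    using tendsto_ennrealI[OF B(2)] by simp
  ultimately show "(\<lambda>i. \<integral>\<^sup>+\<omega>. ennreal (mdist (cont_space K) (X \<omega>) (s i \<omega>)) \<partial>M) \<longlonglongrightarrow> 0"
    using tendsto_sandwich[OF _ _ tendsto_const, of _ _ sequentially "\<lambda>i. ennreal (B i)"] by simp
  have "mdist (cont_space K) (simple_cont_integral M K (s i)) e \<le> B i" for i
  proof (rule mdist_cont_space_le[OF B(1)])
    fix x
    assume x: "x \<in> K"
    note si = simple_cont_integral_eval[OF s x]
    have X': "integrable M (\<lambda>\<omega>. X \<omega> x)" "e x = (\<integral>\<omega>. X \<omega> x \<partial>M)"
      using int[OF x] by (auto simp: has_bochner_integral_iff)
    have "\<bar>simple_cont_integral M K (s i) x - e x\<bar> = \<bar>\<integral>\<omega>. s i \<omega> x - X \<omega> x \<partial>M\<bar>"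
      using si X' by simp
    also have "\<dots> \<le> (\<integral>\<omega>. \<bar>s i \<omega> x - X \<omega> x\<bar> \<partial>M)"
      by (rule integral_abs_bound)
    also have "\<dots> \<le> (\<integral>\<omega>. B i \<partial>M)"
      using si X' close x by (intro integral_mono) (auto simp: abs_minus_commute)
    finally show "\<bar>simple_cont_integral M K (s i) x - e x\<bar> \<le> B i"
      by (simp add: prob_space)
  qed
  moreover have "0 \<le> mdist (cont_space K) (simple_cont_integral M K (s i)) e" for i
    by simp
  ultimately show "(\<lambda>i. mdist (cont_space K) (simple_cont_integral M K (s i)) e) \<longlonglongrightarrow> 0"
    using tendsto_sandwich[OF _ _ tendsto_const B(2)] by simp
qed

section \<open>Limit theorems\<close>

text \<open>This serves to renumber a sequence indexed from 1 as one indexed from 0. Independence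
  concerns finite subfamilies, and an injective \<open>f\<close> matches those over \<open>J\<close>
  with those over the image of \<open>J\<close> without merging factors of the product.\<close>

lemma (in prob_space) indep_sets_reindex:
  assumes inj: "inj_on f I" and indep: "indep_sets F (f ` I)"
  shows "indep_sets (\<lambda>i. F (f i)) I"
  unfolding indep_sets_def
proof (intro conjI ballI allI impI)
  show "F (f i) \<subseteq> events" if "i \<in> I" for i
    using indep that by (auto simp: indep_sets_def)
  fix J A
  assume J: "J \<subseteq> I" "J \<noteq> {}" "finite J" and A: "A \<in> (\<Pi> i\<in>J. F (f i))"
  define B where "B k = A (the_inv_into I f k)" for k
  have B: "B (f j) = A j" if "j \<in> J" for j
    using that J inj by (auto simp: B_def the_inv_into_f_f subsetD)
  have "prob (\<Inter>k\<in>f ` J. B k) = (\<Prod>k\<in>f ` J. prob (B k))"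
    using J A B by (intro indep_setsD[OF indep]) auto
  then show "prob (\<Inter>j\<in>J. A j) = (\<Prod>j\<in>J. prob (A j))"
    using B inj_on_subset[OF inj J(1)] by (simp add: prod.reindex)
qed

lemma (in prob_space) indep_vars_reindex:
  assumes "inj_on f I" "indep_vars N X (f ` I)"
  shows "indep_vars (\<lambda>i. N (f i)) (\<lambda>i. X (f i)) I"
  using assms indep_sets_reindex[OF assms(1)] by (auto simp: indep_vars_def2)

section \<open>The strong law of large numbers for bounded variables\<close>

text \<open>Hoeffding's inequality bounds the probability of an error of at least
  \<open>\<epsilon>\<close> by a geometric sequence. This is summable, so by Borel-Cantelli such
  errors almost surely stop occurring.\<close>

lemma (in prob_space) strong_law_bounded_iid:
  fixes X :: "nat \<Rightarrow> 'a \<Rightarrow> real"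
  assumes indep: "indep_vars (\<lambda>_. borel) X {1..}"
    and ident: "\<And>n. n \<ge> 1 \<Longrightarrow> distr M borel (X n) = distr M borel (X 1)"
    and bounded: "AE \<omega> in M. X 1 \<omega> \<in> {a..b}" and "a < b"
  shows "AE \<omega> in M. (\<lambda>n. (\<Sum>j=1..n. X j \<omega>) / n) \<longlonglongrightarrow> expectation (X 1)"
proof -
  have rv [measurable]: "X n \<in> borel_measurable M" if "n \<ge> 1" for n
    using indep that by (auto simp: indep_vars_def)
  have rvn [measurable]: "(\<lambda>\<omega>. (\<Sum>j=1..n. X j \<omega>) / n) \<in> borel_measurable M" for n
    by (intro borel_measurable_divide borel_measurable_sum) auto
  have "AE \<omega> in M. \<forall>\<^sub>F n in sequentially. \<bar>(\<Sum>j=1..n. X j \<omega>) / n - expectation (X 1)\<bar> < \<epsilon>"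
    if "\<epsilon> > 0" for \<epsilon>
  proof -
    define A where "A n = {\<omega> \<in> space M. \<bar>(\<Sum>j=1..n. X j \<omega>) / n - expectation (X 1)\<bar> \<ge> \<epsilon>}" for n :: nat
    \<comment> \<open>Hoeffding's exponent is linear in \<open>n\<close>, so its two-sided bound
      takes the form \<open>2 * q ^ n\<close>.\<close>
    define q where "q = exp (-2 * \<epsilon>\<^sup>2 / (b - a)\<^sup>2)"
    have q: "0 \<le> q" "q < 1"
      using \<open>\<epsilon> > 0\<close> \<open>a < b\<close> by (auto simp: q_def)
    have A: "A n \<in> sets M" for n
      unfolding A_def using rvn[of n] by measurable
    have bound: "prob (A n) \<le> 2 * q ^ n" for n
    proof (cases "n = 0")
      \<comment> \<open>For \<open>n = 0\<close> the bound is 2, which exceeds every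
        probability.\<close>
      case True
      then show ?thesis using prob_le_1[of "A n"] by (simp del: prob_le_1)
    next
      case False
      have "Hoeffding_ineq_iid M {1..n} X (X 1) a b"
      proof unfold_locales
        show "indep_vars (\<lambda>_. borel) X {1..n}"
          by (rule indep_vars_subset[OF indep]) auto
        show "distr M borel (X i) = distr M borel (X 1)" if "i \<in> {1..n}" for i
          using that by (intro ident) simp
      qed (simp_all only: rv bounded order_refl finite_atLeastAtMost)
      from Hoeffding_ineq_iid.Hoeffding_ineq_abs_ge'[OF this, of \<epsilon>]
      have "prob (A n) \<le> 2 * exp (- 2 * n * \<epsilon>\<^sup>2 / (b - a)\<^sup>2)"
        using False \<open>\<epsilon> > 0\<close> \<open>a < b\<close> by (simp add: A_def)
      also have "exp (- 2 * n * \<epsilon>\<^sup>2 / (b - a)\<^sup>2) = q ^ n"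
        by (simp add: q_def exp_of_nat_mult[symmetric] mult_ac)
      finally show ?thesis .
    qed
    have "summable (\<lambda>n. prob (A n))"
    proof (rule summable_comparison_test')
      show "summable (\<lambda>n. 2 * q ^ n)"
        using q by (intro summable_mult summable_geometric) auto
      show "norm (prob (A n)) \<le> 2 * q ^ n" if "n \<ge> 0" for n
        using bound[of n] by simp
    qed
    from borel_cantelli_AE1[OF A _ this] have "AE \<omega> in M. \<forall>\<^sub>F n in sequentially. \<omega> \<in> space M - A n"
      by (auto simp: less_top[symmetric])
    then show ?thesis
      by (rule AE_mp) (auto simp: A_def not_le elim!: eventually_mono intro!: AE_I2)
  qed
  \<comment> \<open>The tolerances \<open>1 / (k + 1)\<close> are countably many, so one null set
    serves for all of them.\<close>
  then have "AE \<omega> in M. \<forall>k. \<forall>\<^sub>F n in sequentially.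
      \<bar>(\<Sum>j=1..n. X j \<omega>) / n - expectation (X 1)\<bar> < inverse (real (Suc k))"
    by (simp add: AE_all_countable del: of_nat_Suc)
  then show ?thesis
  proof (rule AE_mp, intro AE_I2 impI)
    fix \<omega>
    assume *: "\<forall>k. \<forall>\<^sub>F n in sequentially.
      \<bar>(\<Sum>j=1..n. X j \<omega>) / n - expectation (X 1)\<bar> < inverse (real (Suc k))"
    show "(\<lambda>n. (\<Sum>j=1..n. X j \<omega>) / n) \<longlonglongrightarrow> expectation (X 1)"
    proof (rule tendstoI)
      fix \<epsilon> :: real
      assume "\<epsilon> > 0"
      then obtain k where "inverse (real (Suc k)) < \<epsilon>"
        using reals_Archimedean by blast
      with *[rule_format, of k]
      show "\<forall>\<^sub>F n in sequentially. dist ((\<Sum>j=1..n. X j \<omega>) / n) (expectation (X 1)) < \<epsilon>"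
        by (auto simp: dist_real_def elim!: eventually_mono)
    qed
  qed
qed

section \<open>Weak convergence and the central limit theorem\<close>

text \<open>The continuous mapping theorem: weak convergence is tested on bounded continuous
  \<open>g\<close>, and \<open>g (f x)\<close> is again bounded and continuous in
  \<open>x\<close>.\<close>

lemma weak_conv_m_continuous_distr:
  fixes f :: "real \<Rightarrow> real"
  assumes \<mu>: "\<And>n. real_distribution (\<mu> n)" and \<nu>: "real_distribution \<nu>"
    and conv: "weak_conv_m \<mu> \<nu>" and f: "\<And>x. isCont f x"
  shows "weak_conv_m (\<lambda>n. distr (\<mu> n) borel f) (distr \<nu> borel f)"
proof -
  have f_borel: "f \<in> borel_measurable borel"
    using f by (intro borel_measurable_continuous_onI continuous_at_imp_continuous_on) simp
  have f_meas: "f \<in> borel_measurable N" if "real_distribution N" for N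
    using f_borel measurable_cong_sets[OF real_distribution.events_eq_borel[OF that] refl] by blast
  have rd: "real_distribution (distr N borel f)" if "real_distribution N" for N
    using prob_space.real_distribution_distr[OF real_distribution.axioms(1)[OF that] f_meas[OF that]] .
  show ?thesis
  proof (rule integral_bdd_continuous_conv_imp_weak_conv[OF rd[OF \<mu>] rd[OF \<nu>]])
    fix g :: "real \<Rightarrow> real"
    assume g: "\<And>x. isCont g x" "\<And>x. \<bar>g x\<bar> \<le> 1"
    have gm: "g \<in> borel_measurable borel"
      using g by (intro borel_measurable_continuous_onI continuous_at_imp_continuous_on) simp
    have "(\<lambda>n. \<integral>x. g (f x) \<partial>\<mu> n) \<longlonglongrightarrow> (\<integral>x. g (f x) \<partial>\<nu>)"
      using g f by (intro weak_conv_imp_integral_bdd_continuous_conv[OF \<mu> \<nu> conv, where B = 1])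
        (auto intro: isCont_o2)
    then show "(\<lambda>n. integral\<^sup>L (distr (\<mu> n) borel f) g) \<longlonglongrightarrow> integral\<^sup>L (distr \<nu> borel f) g"
      by (simp add: integral_distr[OF f_meas[OF \<mu>] gm] integral_distr[OF f_meas[OF \<nu>] gm])
  qed
qed

text \<open>Scaling a standard normal variable by \<open>sqrt v\<close> gives variance
  \<open>v\<close>. This links the standard normal limit of the central limit theorem with
  \<open>normal_law\<close>.\<close>

lemma normal_law_eq_distr:
  assumes "v > 0"
  shows "normal_law 0 v = distr std_normal_distribution borel (\<lambda>z. sqrt v * z)"
proof -
  interpret S: prob_space std_normal_distribution
    by (rule prob_space_normal_density) simp
  have "distributed std_normal_distribution lborel (\<lambda>z. z) std_normal_density"
    by (auto simp: distributed_def intro!: measure_eqI simp: emeasure_distr)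
  from S.normal_density_affine[OF this, of "sqrt v" 0] assms
  have "distributed std_normal_distribution lborel (\<lambda>z. sqrt v * z) (normal_density 0 (sqrt v))"
    by simp
  then have "distr std_normal_distribution lborel (\<lambda>z. sqrt v * z) = normal_law 0 v"
    using assms by (simp add: distributed_def normal_law_def)
  \<comment> \<open>\<open>lborel\<close> and \<open>borel\<close> have the same space and sets, and
    \<open>distr\<close> depends on its target only through these.\<close>
  moreover have "distr std_normal_distribution lborel (\<lambda>z. sqrt v * z)
      = distr std_normal_distribution borel (\<lambda>z. sqrt v * z)"
    by (rule distr_cong) auto
  ultimately show ?thesis by simp
qed

text \<open>For positive variance the central limit theorem for the standardised sums is followed by
  the continuous mapping theorem for \<open>f (\<sigma> * z)\<close>. For zero variance the sums
  cannot be standardised, but then each \<open>X n\<close> is almost surely constant.\<close>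

lemma (in prob_space) weak_conv_normal_law_iid:
  fixes X :: "nat \<Rightarrow> 'a \<Rightarrow> real"
  assumes indep: "indep_vars (\<lambda>_. borel) X {1..}"
    and ident: "\<And>n. n \<ge> 1 \<Longrightarrow> distr M borel (X n) = distr M borel (X 1)"
    and sq: "integrable M (\<lambda>\<omega>. (X 1 \<omega>)\<^sup>2)"
    and f: "\<And>x. isCont f x"
  shows "weak_conv_m
    (\<lambda>n. distr M borel (\<lambda>\<omega>. f (sqrt n * ((\<Sum>j=1..n. X j \<omega>) / n - expectation (X 1)))))
    (distr (normal_law 0 (variance (X 1))) borel f)"
proof -
  define m where "m = expectation (X 1)"
  define \<sigma> where "\<sigma> = sqrt (variance (X 1))"
  have rv [measurable]: "X n \<in> borel_measurable M" if "n \<ge> 1" for n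
    using indep that by (auto simp: indep_vars_def)
  have f_borel [measurable]: "f \<in> borel_measurable borel"
    using f by (intro borel_measurable_continuous_onI continuous_at_imp_continuous_on) simp
  have transfer: "expectation (\<lambda>\<omega>. h (X n \<omega>)) = expectation (\<lambda>\<omega>. h (X 1 \<omega>))"
      "integrable M (\<lambda>\<omega>. h (X n \<omega>)) \<longleftrightarrow> integrable M (\<lambda>\<omega>. h (X 1 \<omega>))"
    if "n \<ge> 1" "h \<in> borel_measurable borel" for h :: "real \<Rightarrow> real" and n
    using ident[OF that(1)] that rv
    by (metis integral_distr order_refl, metis integrable_distr_eq order_refl)
  have int1: "integrable M (X 1)"
    by (rule square_integrable_imp_integrable[OF _ sq]) simp
  \<comment> \<open>The sum over \<open>1..n\<close> becomes one over \<open>i < n\<close>, because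
    the central limit theorem numbers its variables from 0.\<close>
  have mean: "(\<Sum>j=1..n. X j \<omega>) / n - m = (\<Sum>i<n. X (Suc i) \<omega> - m) / n" if "n > 0" for n \<omega>
    using that by (simp add: sum_subtractf sum.atLeast1_atMost_eq field_simps)
  show ?thesis
  proof (cases "variance (X 1) = 0")
    case True
    \<comment> \<open>A nonnegative function with integral 0 vanishes almost everywhere, so
      \<open>X n\<close> equals \<open>m\<close> almost surely. All laws of the sequence and the
      limit law are then the Dirac law at \<open>f 0\<close>.\<close>
    have "AE \<omega> in M. X n \<omega> = m" if "n \<ge> 1" for n
    proof -
      have int: "integrable M (\<lambda>\<omega>. (X n \<omega> - m)\<^sup>2)"
        using transfer(2)[OF that, of "\<lambda>t. (t - m)\<^sup>2"] sq int1
        by (simp add: power2_diff)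
      have "expectation (\<lambda>\<omega>. (X n \<omega> - m)\<^sup>2) = 0"
        using transfer(1)[OF that, of "\<lambda>t. (t - m)\<^sup>2"] True by (simp add: m_def)
      with int have "AE \<omega> in M. (X n \<omega> - m)\<^sup>2 = 0"
        by (subst (asm) integral_nonneg_eq_0_iff_AE) auto
      then show ?thesis by simp
    qed
    then have "AE \<omega> in M. \<forall>n. n \<ge> 1 \<longrightarrow> X n \<omega> = m"
      by (subst AE_all_countable) auto
    then have ae: "AE \<omega> in M. f (sqrt n * ((\<Sum>j=1..n. X j \<omega>) / n - m)) = f 0" for n :: nat
      by (rule AE_mp) (auto intro!: AE_I2)
    have "distr M borel (\<lambda>\<omega>. f (sqrt n * ((\<Sum>j=1..n. X j \<omega>) / n - m))) = return borel (f 0)" for n :: nat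
    proof -
      have "distr M borel (\<lambda>\<omega>. f (sqrt n * ((\<Sum>j=1..n. X j \<omega>) / n - m))) = distr M borel (\<lambda>_. f 0)"
        by (intro distr_cong_AE refl ae measurable_compose[OF _ f_borel]
            borel_measurable_times borel_measurable_diff borel_measurable_divide
            borel_measurable_sum) auto
      then show ?thesis by (simp add: distr_const)
    qed
    moreover have "distr (normal_law 0 (variance (X 1))) borel f = return borel (f 0)"
      using True by (simp add: normal_law_def distr_return)
    ultimately show ?thesis
      by (simp add: m_def weak_conv_m_def weak_conv_def)
  next
    case False
    have var_pos: "variance (X 1) > 0"
      using False variance_positive[of "X 1"] by linarith
    then have \<sigma>: "\<sigma> > 0" "\<sigma>\<^sup>2 = variance (X 1)"
      by (simp_all add: \<sigma>_def)
    define T where "T n \<omega> = (\<Sum>i<n. X (Suc i) \<omega> - m) / sqrt (n * \<sigma>\<^sup>2)" for n :: nat and \<omega>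
    have T_meas [measurable]: "T n \<in> borel_measurable M" for n
      unfolding T_def by (intro borel_measurable_divide borel_measurable_sum) auto
    have "indep_vars (\<lambda>_. borel) (\<lambda>n. X (Suc n)) UNIV"
    proof -
      have "indep_vars (\<lambda>_. borel) X (Suc ` UNIV)"
        using indep_vars_subset[OF indep, of "Suc ` UNIV"] by auto
      from indep_vars_reindex[OF _ this] show ?thesis by simp
    qed
    moreover have "expectation (X (Suc n)) = m" for n
      using transfer(1)[of "Suc n" "\<lambda>x. x"] by (simp add: m_def)
    moreover have "integrable M (\<lambda>\<omega>. (X (Suc n) \<omega>)\<^sup>2)" for n
      using transfer(2)[of "Suc n" "\<lambda>x. x\<^sup>2"] sq by simp
    moreover have "variance (X (Suc n)) = \<sigma>\<^sup>2" for n
      using transfer(1)[of "Suc n" "\<lambda>x. (x - m)\<^sup>2"] transfer(1)[of "Suc n" "\<lambda>x. x"] \<sigma>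
      by (simp add: m_def)
    moreover have "distr M borel (X (Suc n)) = distr M borel (X 1)" for n
      by (rule ident) simp
    ultimately have "weak_conv_m (\<lambda>n. distr M borel (T n)) std_normal_distribution"
      unfolding T_def using \<sigma>(1) by (intro central_limit_theorem)
    then have "weak_conv_m (\<lambda>n. distr (distr M borel (T n)) borel (\<lambda>z. f (\<sigma> * z)))
        (distr std_normal_distribution borel (\<lambda>z. f (\<sigma> * z)))"
      by (intro weak_conv_m_continuous_distr real_distribution_distr T_meas)
         (auto intro: real_dist_normal_dist isCont_o2[where g = f] f)
    moreover have "distr (distr M borel (T n)) borel (\<lambda>z. f (\<sigma> * z))
        = distr M borel (\<lambda>\<omega>. f (sqrt n * ((\<Sum>j=1..n. X j \<omega>) / n - m)))" for n
    proof -
      have "\<sigma> * T n \<omega> = sqrt n * ((\<Sum>j=1..n. X j \<omega>) / n - m)" for \<omega>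
      proof (cases "n = 0")
        case False
        then have n: "sqrt (real n) * sqrt (real n) = real n" "sqrt (real n) > 0" by auto
        have "\<sigma> * T n \<omega> = (\<Sum>i<n. X (Suc i) \<omega> - m) / sqrt n"
          using \<sigma>(1) by (simp add: T_def real_sqrt_mult)
        also have "\<dots> = sqrt n * ((\<Sum>i<n. X (Suc i) \<omega> - m) / n)"
          using n by (simp add: field_simps)
        also have "(\<Sum>i<n. X (Suc i) \<omega> - m) / n = (\<Sum>j=1..n. X j \<omega>) / n - m"
          using False by (intro mean[symmetric]) simp
        finally show ?thesis .
      \<comment> \<open>For \<open>n = 0\<close> both sides are 0: the sum on the left is empty, and
        \<open>sqrt 0\<close> is a factor on the right.\<close>
      qed (simp add: T_def)
      then show ?thesis by (simp add: distr_distr comp_def)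
    qed
    moreover have "distr std_normal_distribution borel (\<lambda>z. f (\<sigma> * z))
        = distr (normal_law 0 (variance (X 1))) borel f"
      unfolding normal_law_eq_distr[OF var_pos] \<sigma>_def by (simp add: distr_distr comp_def)
    ultimately show ?thesis by (simp add: m_def)
  qed
qed

text \<open>By continuity a countable dense subset of \<open>K\<close> gives the same supremum, and
  countable suprema preserve measurability. Compactness keeps the values bounded above, as real
  suprema require.\<close>

lemma borel_measurable_SUP_continuous:
  fixes g :: "'w \<Rightarrow> 'a::{metric_space, second_countable_topology} \<Rightarrow> real"
  assumes K: "compact K" "K \<noteq> {}"
    and cont: "\<And>\<omega>. \<omega> \<in> space M \<Longrightarrow> continuous_on K (g \<omega>)"
    and meas: "\<And>x. x \<in> K \<Longrightarrow> (\<lambda>\<omega>. g \<omega> x) \<in> borel_measurable M"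
  shows "(\<lambda>\<omega>. SUP x\<in>K. g \<omega> x) \<in> borel_measurable M"
proof -
  obtain T where T: "countable T" "T \<subseteq> K" "K \<subseteq> closure T"
    using separable by blast
  have "T \<noteq> {}"
    using T K by auto
  have cl: "closure T = K"
    using T K(1) by (simp add: antisym closure_minimal compact_imp_closed)
  have bdd: "bdd_above (g \<omega> ` K)" if "\<omega> \<in> space M" for \<omega>
    using compact_continuous_image[OF cont[OF that] K(1)] by (intro bounded_imp_bdd_above compact_imp_bounded)
  then have bddT: "bdd_above (g \<omega> ` T)" if "\<omega> \<in> space M" for \<omega>
    using that T(2) by (meson bdd_above_mono image_mono)
  have "(SUP x\<in>K. g \<omega> x) = (SUP x\<in>T. g \<omega> x)" if \<omega>: "\<omega> \<in> space M" for \<omega>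
  proof (rule antisym)
    show "(SUP x\<in>K. g \<omega> x) \<le> (SUP x\<in>T. g \<omega> x)"
    proof (rule cSUP_least[OF K(2)])
      fix x
      assume x: "x \<in> K"
      show "g \<omega> x \<le> (SUP x\<in>T. g \<omega> x)"
      proof (rule continuous_le_on_closure[of T])
        show "continuous_on (closure T) (g \<omega>)" "x \<in> closure T"
          using cont[OF \<omega>] x by (simp_all add: cl)
        show "g \<omega> y \<le> (SUP x\<in>T. g \<omega> x)" if "y \<in> T" for y
          using that by (rule cSUP_upper[OF _ bddT[OF \<omega>]])
      qed
    qed
    show "(SUP x\<in>T. g \<omega> x) \<le> (SUP x\<in>K. g \<omega> x)"
      by (rule cSUP_subset_mono[OF \<open>T \<noteq> {}\<close> bdd[OF \<omega>] T(2)]) simp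
  qed
  moreover have "(\<lambda>\<omega>. SUP x\<in>T. g \<omega> x) \<in> borel_measurable M"
  proof (rule borel_measurable_cSUP[OF T(1)])
    show "(\<lambda>\<omega>. g \<omega> x) \<in> borel_measurable M" if "x \<in> T" for x
      using that T(2) by (intro meas) auto
  qed (rule bddT)
  ultimately show ?thesis
    by (subst measurable_cong)
qed

section \<open>Weighted arithmetic means with a random weight\<close>

text \<open>The weight may be any real, so that \<open>wmean I\<close> is a map on the whole line
  whose measurability follows from continuity. Restriction to the cube makes its values
  extensional.\<close>

definition wmean :: "real set \<Rightarrow> real \<Rightarrow> real^2 \<Rightarrow> real" where
  "wmean I t = (\<lambda>x\<in>cube I. t * x $ 1 + (1 - t) * x $ 2)"

lemma cube_atLeastAtMost: "cube {a..b} = cbox (\<chi> i. a) (\<chi> i. b)"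
  by (auto simp: cube_def mem_box_cart)

lemma compact_cube: "compact (cube {a..b::real})"
  by (simp add: cube_atLeastAtMost)

lemma cube_abs_diff_le:
  assumes "x \<in> cube {a..b}"
  shows "\<bar>x $ i - x $ j\<bar> \<le> b - a"
proof -
  have "x $ i \<in> {a..b}" "x $ j \<in> {a..b}"
    using assms by (auto simp: cube_def)
  then show ?thesis by auto
qed

lemma wmean_mspace: "wmean {a..b} t \<in> mspace (cont_space (cube {a..b}))"
proof -
  have "continuous_on (cube {a..b}) (\<lambda>x::real^2. t * x $ 1 + (1 - t) * x $ 2)"
    by (intro continuous_intros)
  then show ?thesis
    by (auto simp: mspace_cont_space[OF compact_cube] wmean_def cong: continuous_on_cong)
qed

lemma wmean_means:
  assumes "t \<in> {0..1}"
  shows "wmean {a..b} t \<in> means {a..b}"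
proof -
  have "min u v \<le> t * u + (1 - t) * v \<and> t * u + (1 - t) * v \<le> max u v" for u v :: real
  proof -
    \<comment> \<open>The interval between the smaller and the larger of \<open>u\<close> and
      \<open>v\<close> is convex.\<close>
    have "t * u + (1 - t) * v \<in> {min u v..max u v}"
      using assms convexD[of "{min u v..max u v}" u v t "1 - t"] by auto
    then show ?thesis by simp
  qed
  then show ?thesis
    using wmean_mspace by (auto simp: means_def wmean_def UNIV_2)
qed

lemma means_mem:
  assumes "m \<in> means {a..b}" "x \<in> cube {a..b}"
  shows "m x \<in> {a..b}"
proof -
  have "a \<le> Min (range (\<lambda>i. x $ i))" "Max (range (\<lambda>i. x $ i)) \<le> b"
    using assms(2) by (auto simp: cube_def)
  moreover have "Min (range (\<lambda>i. x $ i)) \<le> m x" "m x \<le> Max (range (\<lambda>i. x $ i))"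
    using assms by (auto simp: means_def)
  ultimately show ?thesis
    unfolding atLeastAtMost_iff by (metis order_trans)
qed

text \<open>Through this identity distances between weighted means become distances between weights;
  the Lipschitz bound and the exact supremum both rest on it.\<close>

lemma wmean_diff:
  assumes "x \<in> cube I"
  shows "wmean I s x - wmean I t x = (s - t) * (x $ 1 - x $ 2)"
  using assms by (simp add: wmean_def algebra_simps)

lemma abs_wmean_diff_le:
  assumes "x \<in> cube {a..b}"
  shows "\<bar>wmean {a..b} s x - wmean {a..b} t x\<bar> \<le> (b - a) * \<bar>s - t\<bar>"
  using mult_left_mono[OF cube_abs_diff_le[OF assms, of 1 2], of "\<bar>s - t\<bar>"] assms
  by (simp add: wmean_diff abs_mult mult.commute)

lemma SUP_abs_diff:
  fixes a b :: real
  assumes "a \<le> b"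
  shows "(SUP (x1, x2)\<in>{a..b} \<times> {a..b}. \<bar>x1 - x2\<bar>) = b - a"
proof (rule cSup_eq_maximum)
  show "b - a \<in> (\<lambda>(x1, x2). \<bar>x1 - x2\<bar>) ` ({a..b} \<times> {a..b})"
    using assms by (intro image_eqI[of _ _ "(b, a)"]) auto
qed auto

lemma SUP_abs_wmean_diff:
  assumes "a \<le> b"
  shows "(SUP x\<in>cube {a..b}. \<bar>wmean {a..b} s x - wmean {a..b} t x\<bar>) = (b - a) * \<bar>s - t\<bar>"
proof (rule cSup_eq_maximum)
  \<comment> \<open>At the corner \<open>(b, a)\<close> the coordinates are as far apart as
    possible, so the supremum is attained there.\<close>
  define v :: "real^2" where "v = vector [b, a]"
  have v: "v $ 1 = b" "v $ 2 = a" "v \<in> cube {a..b}"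
    using assms by (auto simp: v_def cube_def forall_2)
  show "(b - a) * \<bar>s - t\<bar> \<in> (\<lambda>x. \<bar>wmean {a..b} s x - wmean {a..b} t x\<bar>) ` cube {a..b}"
    using assms v by (intro image_eqI[of _ _ v]) (simp_all add: wmean_diff abs_mult)
qed (auto intro: abs_wmean_diff_le)

section \<open>Random weighted means and their expectation\<close>

text \<open>In the supremum metric the mean is Lipschitz in its weight with constant
  \<open>b - a\<close>, hence continuous, and the preimages of the generating open sets are
  open.\<close>

lemma measurable_wmean:
  assumes "a \<le> b"
  shows "wmean {a..b} \<in> measurable borel (borel_cont (cube {a..b}))"
  unfolding borel_cont_def
proof (rule measurable_measure_of[OF borel_cont_generators])
  show "wmean {a..b} \<in> space borel \<rightarrow> mspace (cont_space (cube {a..b}))"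
    using wmean_mspace by blast
  have "Lipschitz_continuous_map euclidean_metric (cont_space (cube {a..b})) (wmean {a..b})"
    unfolding Lipschitz_continuous_map_def
    using wmean_mspace assms
    by (auto intro!: exI[of _ "b - a"] mdist_cont_space_le abs_wmean_diff_le simp: dist_real_def)
  then have cont: "continuous_map euclidean (mtopology_of (cont_space (cube {a..b}))) (wmean {a..b})"
    using Lipschitz_continuous_imp_continuous_map by fastforce
  fix U :: "(real^2 \<Rightarrow> real) set"
  assume "U \<in> {U. openin (mtopology_of (cont_space (cube {a..b}))) U}"
  with cont have "open (wmean {a..b} -` U)"
    by (simp add: continuous_map vimage_def)
  then show "wmean {a..b} -` U \<inter> space borel \<in> sets borel"
    by simp
qed

lemma measurable_random_wmean:
  assumes "a \<le> b" and [measurable]: "\<xi> \<in> borel_measurable P" and m: "m \<in> means {a..b}"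
    and X: "\<And>\<omega>. \<omega> \<in> space P \<Longrightarrow> X \<omega> = (if \<xi> \<omega> \<in> {0..1} then wmean {a..b} (\<xi> \<omega>) else m)"
  shows "X \<in> measurable P (borel_cont (cube {a..b}))"
proof -
  note [measurable] = measurable_wmean[OF assms(1)]
  have [simp]: "m \<in> space (borel_cont (cube {a..b}))"
    using m by (simp add: space_borel_cont means_def)
  have "(\<lambda>\<omega>. if \<xi> \<omega> \<in> {0..1} then wmean {a..b} (\<xi> \<omega>) else m) \<in> measurable P (borel_cont (cube {a..b}))"
    by measurable
  with X show ?thesis
    by (simp cong: measurable_cong)
qed

text \<open>The exceptional mean \<open>m\<close> is built into \<open>F\<close> for
  \<open>v\<close> outside [0,1], so that \<open>X\<close> and \<open>F\<close> agree at every
  \<open>\<omega>\<close> of the space and not merely almost surely. Joint measurability holds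
  because \<open>m\<close> and the coordinates are continuous.\<close>

lemma (in prob_space) random_mean_wmean:
  assumes "a \<le> b" and \<xi>: "\<xi> \<in> borel_measurable M" and m: "m \<in> means {a..b}"
    and X: "\<And>\<omega>. \<omega> \<in> space M \<Longrightarrow> X \<omega> = (if \<xi> \<omega> \<in> {0..1} then wmean {a..b} (\<xi> \<omega>) else m)"
  shows "random_mean M {a..b} \<xi> X"
proof -
  let ?K = "cube {a..b} :: (real^2) set"
  define F :: "real^2 \<Rightarrow> real \<Rightarrow> real" where
    "F x v = (if v \<in> {0..1} then wmean {a..b} v x else m x)" for x v
  have Fm: "(\<lambda>x\<in>?K. F x v) = (if v \<in> {0..1} then wmean {a..b} v else m)" for v
    using m by (auto simp: F_def wmean_def means_def mspace_cont_space[OF compact_cube] extensional_def restrict_def)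
  have F_means: "(if v \<in> {0..1} then wmean {a..b} v else m) \<in> means {a..b}" for v
    using m wmean_means by auto
  have F_mem: "F x v \<in> {a..b}" if "x \<in> ?K" for x v
  proof -
    have "F x v = (if v \<in> {0..1} then wmean {a..b} v else m) x"
      by (simp add: F_def)
    then show ?thesis
      using means_mem[OF F_means that] by (simp only:)
  qed
  let ?N = "restrict_space borel ?K \<Otimes>\<^sub>M (borel :: real measure)"
  have comp: "(\<lambda>p. h (fst p)) \<in> borel_measurable ?N" if "continuous_on ?K h" for h :: "real^2 \<Rightarrow> real"
    by (rule measurable_compose[OF measurable_fst borel_measurable_continuous_on_restrict[OF that]])
  have [measurable]: "(\<lambda>p. m (fst p)) \<in> borel_measurable ?N"
      "(\<lambda>p. fst p $ 1) \<in> borel_measurable ?N" "(\<lambda>p. fst p $ 2) \<in> borel_measurable ?N"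
    using m by (auto intro!: comp continuous_intros simp: means_def mspace_cont_space[OF compact_cube])
  \<comment> \<open>On the cube \<open>wmean\<close> is given by its formula, so \<open>F\<close>
    can be expressed through the two projections.\<close>
  have "(\<lambda>p. if snd p \<in> {0..1} then snd p * fst p $ 1 + (1 - snd p) * fst p $ 2 else m (fst p))
      \<in> borel_measurable ?N"
    by measurable
  also have "?this \<longleftrightarrow> (\<lambda>(x, v). F x v) \<in> borel_measurable ?N"
    by (rule measurable_cong) (auto simp: F_def wmean_def space_pair_measure space_restrict_space)
  finally have "(\<lambda>(x, v). F x v) \<in> measurable ?N (restrict_space borel {a..b})"
    using F_mem by (intro measurable_restrict_space2) (auto simp: space_pair_measure space_restrict_space)
  moreover have "(\<lambda>x\<in>?K. F x (\<xi> \<omega>)) \<in> mspace (cont_space ?K)" for \<omega>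
    unfolding Fm using F_means by (simp add: means_def)
  moreover have "{\<omega> \<in> space M. \<forall>x\<in>?K. X \<omega> x = F x (\<xi> \<omega>)} = space M"
    using X by (auto simp: F_def)
  moreover have "X \<in> space M \<rightarrow> means {a..b}"
    using X F_means by simp
  ultimately show ?thesis
    unfolding random_mean_def using \<xi> measurable_random_wmean[OF assms(1) \<xi> m X]
    by (auto simp: prob_space intro!: exI[of _ F])
qed

text \<open>Rounding the weight down to a multiple of \<open>1 / (i + 1)\<close> gives simple functions
  that approximate the random mean uniformly.\<close>

lemma (in prob_space) has_cont_integral_wmean:
  assumes "a \<le> b" and \<xi> [measurable]: "\<xi> \<in> borel_measurable M" and m: "m \<in> means {a..b}"
    and X: "\<And>\<omega>. \<omega> \<in> space M \<Longrightarrow> X \<omega> = (if \<xi> \<omega> \<in> {0..1} then wmean {a..b} (\<xi> \<omega>) else m)"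
    and unit: "AE \<omega> in M. \<xi> \<omega> \<in> {0..1}"
  shows "has_cont_integral M (cube {a..b}) X (wmean {a..b} (expectation \<xi>))"
proof -
  \<comment> \<open>\<open>k i\<close> is the numerator of the rounded weight; the value -1 marks
    weights outside [0,1], for which the approximation is \<open>m\<close> itself.\<close>
  define k where "k i \<omega> = (if \<xi> \<omega> \<in> {0..1} then \<lfloor>(real i + 1) * \<xi> \<omega>\<rfloor> else -1)" for i \<omega>
  define h where "h i j = (if j < 0 then m else wmean {a..b} (real_of_int j / (real i + 1)))" for i and j :: int
  have X_meas: "X \<in> measurable M (borel_cont (cube {a..b}))"
    by (rule measurable_random_wmean[OF assms(1-4)])
  show ?thesis
  proof (rule has_cont_integralI_uniform[OF compact_cube X_meas])
    show "simple_cont M (cube {a..b}) (\<lambda>\<omega>. h i (k i \<omega>))" for i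
    proof -
      \<comment> \<open>The value \<open>i + 1\<close> is reached at weight 1.\<close>
      have "k i ` space M \<subseteq> {-1..int i + 1}"
      proof (rule image_subsetI)
        fix \<omega>
        show "k i \<omega> \<in> {-1..int i + 1}"
        proof (cases "\<xi> \<omega> \<in> {0..1}")
          case True
          then have "(real i + 1) * \<xi> \<omega> \<le> real i + 1" "0 \<le> (real i + 1) * \<xi> \<omega>"
            by (auto intro: mult_left_le)
          then have "-1 \<le> \<lfloor>(real i + 1) * \<xi> \<omega>\<rfloor>" "\<lfloor>(real i + 1) * \<xi> \<omega>\<rfloor> \<le> int i + 1"
            by linarith+
          with True show ?thesis by (simp add: k_def)
        next
          case False
          then show ?thesis by (simp only: k_def if_False) simp
        qed
      qed
      then have "finite (k i ` space M)"
        by (rule finite_subset) simp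
      moreover have "k i \<in> measurable M (count_space UNIV)"
        unfolding k_def by measurable
      ultimately have "simple_function M (k i)"
        by (simp add: simple_function_eq_measurable)
      then have "simple_function M (\<lambda>\<omega>. h i (k i \<omega>))"
        by (rule simple_function_compose1)
      then show ?thesis
        using m wmean_mspace by (auto simp: simple_cont_def h_def means_def)
    qed
    show "0 \<le> (b - a) / (real i + 1)" for i
      using assms(1) by simp
    show "(\<lambda>i. (b - a) / (real i + 1)) \<longlonglongrightarrow> 0"
      using tendsto_mult_right_zero[OF LIMSEQ_inverse_real_of_nat, of "b - a"]
      by (simp add: divide_inverse add.commute)
    show "\<bar>X \<omega> x - h i (k i \<omega>) x\<bar> \<le> (b - a) / (real i + 1)"
      if \<omega>: "\<omega> \<in> space M" and x: "x \<in> cube {a..b}" for i \<omega> x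
    proof (cases "\<xi> \<omega> \<in> {0..1}")
      case True
      let ?r = "real_of_int \<lfloor>(real i + 1) * \<xi> \<omega>\<rfloor> / (real i + 1)"
      have "0 \<le> (real i + 1) * \<xi> \<omega>"
        using True by simp
      then have "0 \<le> \<lfloor>(real i + 1) * \<xi> \<omega>\<rfloor>"
        by linarith
      then have h: "h i (k i \<omega>) = wmean {a..b} ?r"
        using True unfolding h_def k_def by (simp only: if_True not_less[symmetric] if_False)
      have "\<xi> \<omega> - ?r = ((real i + 1) * \<xi> \<omega> - real_of_int \<lfloor>(real i + 1) * \<xi> \<omega>\<rfloor>) / (real i + 1)"
        by (simp add: field_simps)
      moreover have "\<bar>(real i + 1) * \<xi> \<omega> - real_of_int \<lfloor>(real i + 1) * \<xi> \<omega>\<rfloor>\<bar> \<le> 1"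
        by linarith
      \<comment> \<open>Rounding loses at most \<open>1 / (i + 1)\<close>, and the Lipschitz
        constant \<open>b - a\<close> carries this over to the means.\<close>
      ultimately have "\<bar>\<xi> \<omega> - ?r\<bar> \<le> 1 / (real i + 1)"
        by (simp add: divide_right_mono)
      then have "(b - a) * \<bar>\<xi> \<omega> - ?r\<bar> \<le> (b - a) * (1 / (real i + 1))"
        using assms(1) by (intro mult_left_mono) auto
      moreover have "X \<omega> = wmean {a..b} (\<xi> \<omega>)"
        using X[OF \<omega>] True by simp
      ultimately show ?thesis
        using abs_wmean_diff_le[OF x, of "\<xi> \<omega>" ?r] h by simp
    next
      \<comment> \<open>Here both functions are \<open>m\<close>, so the error is 0.\<close>
      case False
      then show ?thesis
        using X[OF \<omega>] assms(1) unfolding h_def k_def by (simp only: if_False) simp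
    qed
    show "wmean {a..b} (expectation \<xi>) \<in> mspace (cont_space (cube {a..b}))"
      by (rule wmean_mspace)
    show "has_bochner_integral M (\<lambda>\<omega>. X \<omega> x) (wmean {a..b} (expectation \<xi>) x)"
      if x: "x \<in> cube {a..b}" for x
    proof -
      have "integrable M \<xi>"
      proof (rule integrable_const_bound[OF _ \<xi>])
        show "AE \<omega> in M. norm (\<xi> \<omega>) \<le> 1"
          using unit by eventually_elim simp
      qed
      then have "has_bochner_integral M (\<lambda>\<omega>. \<xi> \<omega> * x $ 1 + (1 - \<xi> \<omega>) * x $ 2)
          (expectation \<xi> * x $ 1 + (1 - expectation \<xi>) * x $ 2)"
        by (auto simp: has_bochner_integral_iff prob_space)
      moreover have "AE \<omega> in M. X \<omega> x = \<xi> \<omega> * x $ 1 + (1 - \<xi> \<omega>) * x $ 2"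
        using unit by (rule AE_mp) (use x X in \<open>auto simp: wmean_def intro!: AE_I2\<close>)
      moreover have "(\<lambda>\<omega>. X \<omega> x) \<in> borel_measurable M"
        using measurable_compose[OF X_meas measurable_borel_cont_eval[OF x]] .
      ultimately show ?thesis
        using x by (subst has_bochner_integral_cong_AE[where g = "\<lambda>\<omega>. \<xi> \<omega> * x $ 1 + (1 - \<xi> \<omega>) * x $ 2"])
          (auto simp: wmean_def)
    qed
  qed
qed

section \<open>Reduction of the random means to their real weights\<close>

theorem corollary3p4:
  fixes P :: "'w measure"
    and I :: "real set"
    and \<xi> :: "nat \<Rightarrow> 'w \<Rightarrow> real"
    and mstar :: "real^2 \<Rightarrow> real"
    and M :: "nat \<Rightarrow> 'w \<Rightarrow> real^2 \<Rightarrow> real"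
    and \<kappa> :: "nat \<Rightarrow> 'w \<Rightarrow> real"
  assumes prob: "prob_space P"
    and I: "is_interval I" "compact I" "\<exists>x\<in>I. \<exists>y\<in>I. x \<noteq> y"
    and indep: "prob_space.indep_vars P (\<lambda>_. borel) \<xi> {1..}"
    and ident: "\<And>n. n \<ge> 1 \<Longrightarrow> distr P borel (\<xi> n) = distr P borel (\<xi> 1)"
    and unit: "measure P {\<omega>\<in>space P. \<xi> 1 \<omega> \<in> {0..1}} = 1"
    and mstar: "mstar \<in> means I"
    and M: "\<And>n \<omega>. n \<ge> 1 \<Longrightarrow> \<omega> \<in> space P \<Longrightarrow>
      M n \<omega> = (if \<xi> n \<omega> \<in> {0..1}
               then (\<lambda>x\<in>cube I. \<xi> n \<omega> * x $ 1 + (1 - \<xi> n \<omega>) * x $ 2)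
               else mstar)"
    and \<kappa>: "\<And>n \<omega>. n \<ge> 1 \<Longrightarrow> \<omega> \<in> space P \<Longrightarrow>
      \<kappa> n \<omega> = (SUP x\<in>cube I. \<bar>1 / real n * (\<Sum>j=1..n. M j \<omega> x) - cont_integral P (cube I) (M 1) x\<bar>)"
  shows "(\<forall>n\<ge>1. random_mean P I (\<xi> n) (M n)) \<and>
    cont_integrable P (cube I) (M 1) \<and>
    (\<forall>x\<in>cube I. cont_integral P (cube I) (M 1) x =
        x $ 1 * prob_space.expectation P (\<xi> 1) + x $ 2 * (1 - prob_space.expectation P (\<xi> 1))) \<and>
    measure P {\<omega>\<in>space P. (\<lambda>n. \<kappa> n \<omega>) \<longlonglongrightarrow> 0} = 1 \<and>
    converges_in_distribution P (\<lambda>n \<omega>. sqrt (real n) * \<kappa> n \<omega>)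
      (normal_law 0 (prob_space.variance P (\<xi> 1)))
      (\<lambda>z. (SUP (x1, x2)\<in>I \<times> I. \<bar>x1 - x2\<bar>) * \<bar>z\<bar>)"
proof -
  interpret prob_space P by (rule prob)
  obtain a b where I_eq: "I = {a..b}"
    using I(1,2) is_interval_compact[of I] by auto
  have ab: "a \<le> b"
    using I(3) I_eq by auto
  have K: "cube I \<noteq> ({} :: (real^2) set)" "compact (cube I :: (real^2) set)"
    using ab by (auto simp: I_eq cube_atLeastAtMost interval_eq_empty_cart not_less)
  have rv: "\<xi> n \<in> borel_measurable P" if "n \<ge> 1" for n
    using indep that by (auto simp: indep_vars_def)
  have M': "M n \<omega> = (if \<xi> n \<omega> \<in> {0..1} then wmean {a..b} (\<xi> n \<omega>) else mstar)"
    if "n \<ge> 1" "\<omega> \<in> space P" for n \<omega>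
    using M[OF that] by (simp add: wmean_def I_eq)
  have mstar': "mstar \<in> means {a..b}"
    using mstar I_eq by simp
  have unit1: "AE \<omega> in P. \<xi> 1 \<omega> \<in> {0..1}"
    using unit rv[of 1] by (intro AE_I_eq_1) (simp_all add: emeasure_eq_measure del: One_nat_def)
  \<comment> \<open>Lying in [0,1] almost surely is a property of the law, so it passes from
    \<open>\<xi> 1\<close> to every \<open>\<xi> n\<close>.\<close>
  have unit_n: "AE \<omega> in P. \<xi> n \<omega> \<in> {0..1}" if "n \<ge> 1" for n
  proof -
    have "(AE x in distr P borel (\<xi> 1). x \<in> {0..1})"
      by (subst AE_distr_iff) (use rv[of 1] unit1 in auto)
    then have "(AE x in distr P borel (\<xi> n). x \<in> {0..1})"
      by (simp only: ident[OF that])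
    then show ?thesis
      by (subst (asm) AE_distr_iff) (use rv[OF that] in auto)
  qed
  have unit_all: "AE \<omega> in P. \<forall>n\<ge>1. \<xi> n \<omega> \<in> {0..1}"
    using unit_n by (subst AE_all_countable) auto
  define \<mu> where "\<mu> = expectation (\<xi> 1)"
  have hci: "has_cont_integral P (cube I) (M 1) (wmean I \<mu>)"
    unfolding I_eq \<mu>_def by (rule has_cont_integral_wmean[OF ab rv mstar' M' unit1]) auto
  have E: "cont_integral P (cube I) (M 1) = wmean I \<mu>"
    by (rule cont_integral_eqI[OF hci K(2)])
  define A where "A n \<omega> = (\<Sum>j=1..n. \<xi> j \<omega>) / real n" for n \<omega>
  \<comment> \<open>When all weights lie in [0,1], the average is the weighted mean with weight
    \<open>A n \<omega>\<close>, to be compared with the one of weight \<open>\<mu>\<close>; the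
    supremum of their difference is known exactly.\<close>
  have \<kappa>_eq: "\<kappa> n \<omega> = (b - a) * \<bar>A n \<omega> - \<mu>\<bar>"
    if n: "n \<ge> 1" and \<omega>: "\<omega> \<in> space P" "\<forall>n\<ge>1. \<xi> n \<omega> \<in> {0..1}" for n \<omega>
  proof -
    have "1 / real n * (\<Sum>j=1..n. M j \<omega> x) = wmean {a..b} (A n \<omega>) x" if x: "x \<in> cube {a..b}" for x
    proof -
      have "(\<Sum>j=1..n. M j \<omega> x) = (\<Sum>j=1..n. \<xi> j \<omega> * x $ 1 + (1 - \<xi> j \<omega>) * x $ 2)"
        using \<omega> x by (intro sum.cong) (auto simp: M' wmean_def)
      also have "\<dots> = (\<Sum>j=1..n. \<xi> j \<omega>) * x $ 1 + (real n - (\<Sum>j=1..n. \<xi> j \<omega>)) * x $ 2"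
        by (simp add: sum.distrib sum_subtractf flip: sum_distrib_right)
      finally show ?thesis
        using n x by (simp add: wmean_def A_def field_simps)
    qed
    then have "\<kappa> n \<omega> = (SUP x\<in>cube {a..b}. \<bar>wmean {a..b} (A n \<omega>) x - wmean {a..b} \<mu> x\<bar>)"
      unfolding \<kappa>[OF n \<omega>(1)] E unfolding I_eq by (intro SUP_cong) auto
    then show ?thesis
      by (simp add: SUP_abs_wmean_diff[OF ab])
  qed
  \<comment> \<open>The formula just obtained holds only almost surely, while measurability concerns
    all of the space. It therefore comes from the continuity and measurability of the
    \<open>M j\<close>.\<close>
  have \<kappa>_meas: "\<kappa> n \<in> borel_measurable P" if n: "n \<ge> 1" for n
  proof -
    have M_borel: "M j \<in> measurable P (borel_cont (cube I))" if "j \<ge> 1" for j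
      unfolding I_eq by (rule measurable_random_wmean[OF ab rv[OF that] mstar' M'[OF that]])
    have M_eval: "(\<lambda>\<omega>. M j \<omega> x) \<in> borel_measurable P" if "j \<ge> 1" "x \<in> cube I" for j x
      by (rule measurable_compose[OF M_borel measurable_borel_cont_eval]) (rule that)+
    have M_cont: "continuous_on (cube I) (M j \<omega>)" if "j \<ge> 1" "\<omega> \<in> space P" for j \<omega>
      using measurable_space[OF M_borel[OF that(1)] that(2)]
      by (simp add: space_borel_cont mspace_cont_space[OF K(2)])
    have w_cont: "continuous_on (cube I) (wmean I \<mu>)"
      using wmean_mspace[of a b \<mu>] by (simp add: mspace_cont_space[OF compact_cube] I_eq)
    have "(\<lambda>\<omega>. SUP x\<in>cube I. \<bar>1 / real n * (\<Sum>j=1..n. M j \<omega> x) - wmean I \<mu> x\<bar>) \<in> borel_measurable P"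
      using K
      by (intro borel_measurable_SUP_continuous continuous_intros M_cont w_cont borel_measurable_abs
          borel_measurable_diff borel_measurable_times borel_measurable_sum M_eval borel_measurable_const) auto
    then show ?thesis
      by (rule measurable_cong[THEN iffD2, rotated]) (rule \<kappa>[OF n, unfolded E])
  qed
  have "AE \<omega> in P. (\<lambda>n. A n \<omega>) \<longlonglongrightarrow> \<mu>"
    unfolding A_def \<mu>_def by (rule strong_law_bounded_iid[OF indep ident unit1]) simp_all
  then have "AE \<omega> in P. (\<lambda>n. \<kappa> n \<omega>) \<longlonglongrightarrow> 0"
    using unit_all AE_space
  proof eventually_elim
    case (elim \<omega>)
    have "(\<lambda>n. (b - a) * \<bar>A n \<omega> - \<mu>\<bar>) \<longlonglongrightarrow> (b - a) * \<bar>\<mu> - \<mu>\<bar>"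
      by (intro tendsto_intros elim(1))
    moreover have "\<forall>\<^sub>F n in sequentially. \<kappa> n \<omega> = (b - a) * \<bar>A n \<omega> - \<mu>\<bar>"
      using \<kappa>_eq[OF _ elim(3,2)] by (auto simp: eventually_sequentially)
    ultimately show ?case
      by (simp add: tendsto_cong)
  qed
  \<comment> \<open>\<open>\<kappa> 0\<close> is arbitrary and perhaps not measurable. Shifting the
    index drops it without affecting the limit, and so the event is seen to be measurable.\<close>
  moreover have "{\<omega> \<in> space P. (\<lambda>n. \<kappa> n \<omega>) \<longlonglongrightarrow> 0} = {\<omega> \<in> space P. (\<lambda>n. \<kappa> (Suc n) \<omega>) \<longlonglongrightarrow> 0}"
    by (simp only: filterlim_sequentially_Suc[of "\<lambda>n. \<kappa> n \<omega>" for \<omega>])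
  moreover have "{\<omega> \<in> space P. (\<lambda>n. \<kappa> (Suc n) \<omega>) \<longlonglongrightarrow> 0} \<in> sets P"
  proof -
    have [measurable]: "\<kappa> (Suc n) \<in> borel_measurable P" for n
      by (rule \<kappa>_meas) simp
    show ?thesis by measurable
  qed
  ultimately have lln: "measure P {\<omega> \<in> space P. (\<lambda>n. \<kappa> n \<omega>) \<longlonglongrightarrow> 0} = 1"
    by (subst prob_Collect_eq_1) auto
  \<comment> \<open>Since \<open>sqrt n\<close> can be moved inside the absolute value,
    \<open>sqrt n * \<kappa> n\<close> is almost surely \<open>f\<close> of the scaled error of the
    average weight.\<close>
  define f :: "real \<Rightarrow> real" where "f z = (b - a) * \<bar>z\<bar>" for z
  have f_cont: "isCont f z" for z
    unfolding f_def by (intro continuous_intros)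
  have f_borel [measurable]: "f \<in> borel_measurable borel"
    unfolding f_def by measurable
  have sq: "integrable P (\<lambda>\<omega>. (\<xi> 1 \<omega>)\<^sup>2)"
  proof (rule integrable_const_bound)
    show "AE \<omega> in P. norm ((\<xi> 1 \<omega>)\<^sup>2) \<le> 1"
      using unit1 by eventually_elim (simp add: power_le_one)
    show "(\<lambda>\<omega>. (\<xi> 1 \<omega>)\<^sup>2) \<in> borel_measurable P"
      by (intro borel_measurable_power rv order_refl)
  qed
  have "distr P borel (\<lambda>\<omega>. sqrt n * \<kappa> n \<omega>) = distr P borel (\<lambda>\<omega>. f (sqrt n * (A n \<omega> - \<mu>)))" for n :: nat
  proof (cases "n = 0")
    case False
    then have n: "n \<ge> 1" by simp
    have A_meas: "A n \<in> borel_measurable P"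
      unfolding A_def by (intro borel_measurable_divide borel_measurable_sum rv) auto
    have "AE \<omega> in P. sqrt n * \<kappa> n \<omega> = f (sqrt n * (A n \<omega> - \<mu>))"
      using unit_all AE_space
      by eventually_elim (simp add: \<kappa>_eq[OF n] f_def abs_mult)
    then show ?thesis
      using \<kappa>_meas[OF n] A_meas by (intro distr_cong_AE) auto
  \<comment> \<open>For \<open>n = 0\<close> the factor \<open>sqrt 0\<close> cancels the arbitrary
    \<open>\<kappa> 0\<close>, and both variables are 0.\<close>
  qed (simp add: f_def)
  then have "weak_conv_m (\<lambda>n. distr P borel (\<lambda>\<omega>. sqrt n * \<kappa> n \<omega>))
      (distr (normal_law 0 (variance (\<xi> 1))) borel f)"
    using weak_conv_normal_law_iid[OF indep ident sq f_cont] by (simp only: A_def \<mu>_def)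
  moreover have "(SUP (x1, x2)\<in>I \<times> I. \<bar>x1 - x2\<bar>) * \<bar>z\<bar> = f z" for z
    by (simp add: I_eq SUP_abs_diff[OF ab] f_def)
  moreover have "f \<in> borel_measurable (normal_law 0 v)" for v
    by (simp add: normal_law_def)
  ultimately have clt: "converges_in_distribution P (\<lambda>n \<omega>. sqrt (real n) * \<kappa> n \<omega>)
      (normal_law 0 (variance (\<xi> 1))) (\<lambda>z. (SUP (x1, x2)\<in>I \<times> I. \<bar>x1 - x2\<bar>) * \<bar>z\<bar>)"
    unfolding converges_in_distribution_def using \<kappa>_meas by auto
  have "random_mean P I (\<xi> n) (M n)" if "n \<ge> 1" for n
    unfolding I_eq by (rule random_mean_wmean[OF ab rv[OF that] mstar' M'[OF that]])
  moreover have "cont_integral P (cube I) (M 1) x = x $ 1 * expectation (\<xi> 1) + x $ 2 * (1 - expectation (\<xi> 1))"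
    if "x \<in> cube I" for x
    using that unfolding E \<mu>_def by (simp add: wmean_def mult.commute)
  ultimately show ?thesis
    using hci lln clt unfolding cont_integrable_def by blast
qed

end
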